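(* For every integer $k\ge 0$, the number $a_{k+\frac12}=\sum_\mu a_{k+\frac12}(\mu)$ (sum over all integer partitions $\mu$) satisfies $$a_{k+\frac12}=\sum_{j=0}^{k} S(k+1,j+1)\sum_{\mu\vdash j} f^\mu=\sum_{j=0}^{k} S(k+1,j+1)\, I_j,$$ where $I_j$ is the number of involutions in the symmetric group $\mathfrak{S}_j$ and $I_0=1$.
   Context: Integer partitions are identified with their Young diagrams and ordered by containment; $\emptyset$ is the only partition of $0$. $f^\mu$ is the number of standard Young tableaux of shape $\mu$, with $f^\emptyset=1$. A limiting vacillating tableau of shape $\mu$ and length $2k+1$ is a sequence of $2k+2$ integer partitions $(\mu^{(0)}=\emptyset,\mu^{(1/2)},\mu^{(1)},\dots,\mu^{(k)},\mu^{(k+1/2)}=\mu)$ such that (a) for each integer $j=0,\dots,k$: $\mu^{(j)}\supseteq\mu^{(j+1/2)}$ and $|\mu^{(j)}/\mu^{(j+1/2)}|\in\{0,1\}$; (b) for each integer $j=0,\dots,k-1$: $\mu^{(j+1/2)}\subseteq\mu^{(j+1)}$ and $|\mu^{(j+1)}/\mu^{(j+1/2)}|=1$. $a_{k+\frac12}(\mu)$ is the number of limiting vacillating tableaux of shape $\mu$ and length $2k+1$. $S(\cdot,\cdot)$ denotes Stirling numbers of the second kind. An involution is a permutation $\sigma$ with $\sigma^2=\mathrm{id}$ (the identity is included). *)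

theory Defs
  imports
    "HOL-Library.FuncSet"
    "HOL-Combinatorics.Permutations"
    "HOL-Combinatorics.Stirling"
    "HOL-Analysis.Infinite_Sum"
begin

section \<open>Integer partitions and Young diagrams\<close>

definition integer_partition :: "nat list \<Rightarrow> bool" where
  "integer_partition \<mu> \<longleftrightarrow> sorted_wrt (\<ge>) \<mu> \<and> 0 \<notin> set \<mu>"

definition partitions_of :: "nat \<Rightarrow> nat list set" where
  "partitions_of n = {\<mu>. integer_partition \<mu> \<and> sum_list \<mu> = n}"

text \<open>Cells are pairs (row, column), both counted from 0.\<close>

definition young_diagram :: "nat list \<Rightarrow> (nat \<times> nat) set" where
  "young_diagram \<mu> = {(r, c). r < length \<mu> \<and> c < \<mu> ! r}"

section \<open>Standard Young tableaux\<close>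

text \<open>
  A filling is a function on all of \<^typ>\<open>nat \<times> nat\<close>; requiring it to be extensional on the
  diagram makes every tableau be represented by exactly one function.
\<close>

definition standard_young_tableaux :: "nat list \<Rightarrow> (nat \<times> nat \<Rightarrow> nat) set" where
  "standard_young_tableaux \<mu> =
    {t \<in> extensional (young_diagram \<mu>).
       bij_betw t (young_diagram \<mu>) {1..sum_list \<mu>} \<and>
       (\<forall>r c. (r, Suc c) \<in> young_diagram \<mu> \<longrightarrow> t (r, c) < t (r, Suc c)) \<and>
       (\<forall>r c. (Suc r, c) \<in> young_diagram \<mu> \<longrightarrow> t (r, c) < t (Suc r, c))}"

definition num_syt :: "nat list \<Rightarrow> nat" where
  "num_syt \<mu> = card (standard_young_tableaux \<mu>)"

section \<open>Limiting vacillating tableaux\<close>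

text \<open>
  The entry \<open>v ! i\<close> is the partition with half-integer index \<open>i / 2\<close>, so that integer indices
  sit at even positions. The length of the tableau in the combinatorial sense is \<open>2 * k + 1\<close>,
  the number of steps.
\<close>

definition limiting_vacillating_tableaux :: "nat \<Rightarrow> nat list \<Rightarrow> nat list list set" where
  "limiting_vacillating_tableaux k \<mu> =
    {v. length v = 2 * k + 2 \<and>
        (\<forall>\<nu> \<in> set v. integer_partition \<nu>) \<and>
        v ! 0 = [] \<and> v ! (2 * k + 1) = \<mu> \<and>
        (\<forall>j\<le>k. young_diagram (v ! (2 * j + 1)) \<subseteq> young_diagram (v ! (2 * j)) \<and>
               card (young_diagram (v ! (2 * j)) - young_diagram (v ! (2 * j + 1))) \<in> {0, 1}) \<and>
        (\<forall>j<k. young_diagram (v ! (2 * j + 1)) \<subseteq> young_diagram (v ! (2 * j + 2)) \<and>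
               card (young_diagram (v ! (2 * j + 2)) - young_diagram (v ! (2 * j + 1))) = 1)}"

definition num_lvt :: "nat \<Rightarrow> nat list \<Rightarrow> nat" where
  "num_lvt k \<mu> = card (limiting_vacillating_tableaux k \<mu>)"

text \<open>
  The sum ranges over infinitely many partitions, of which only finitely many contribute
  (see \<open>finite_num_lvt_support\<close> below).
\<close>

definition total_num_lvt :: "nat \<Rightarrow> nat" where
  "total_num_lvt k = (\<Sum>\<^sub>\<infinity>\<mu> | integer_partition \<mu>. num_lvt k \<mu>)"

section \<open>Involutions\<close>

definition num_involutions :: "nat \<Rightarrow> nat" where
  "num_involutions n = card {\<sigma>. \<sigma> permutes {1..n} \<and> \<sigma> \<circ> \<sigma> = id}"

section \<open>Basic facts\<close>

lemma young_diagram_Sigma: "young_diagram \<mu> = (SIGMA r:{..<length \<mu>}. {..<\<mu> ! r})"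
  by (auto simp: young_diagram_def)

lemma finite_young_diagram [simp]: "finite (young_diagram \<mu>)"
  by (simp add: young_diagram_Sigma)

lemma card_young_diagram: "card (young_diagram \<mu>) = sum_list \<mu>"
  by (simp add: young_diagram_Sigma sum_list_sum_nth atLeast0LessThan)

lemma young_diagram_Nil [simp]: "young_diagram [] = {}"
  by (simp add: young_diagram_def)

lemma finite_partitions_le: "finite {\<mu>. integer_partition \<mu> \<and> sum_list \<mu> \<le> n}"
proof (rule finite_subset)
  have "length \<mu> \<le> sum_list \<mu>" if "0 \<notin> set \<mu>" for \<mu> :: "nat list"
    using that by (induction \<mu>) auto
  then show "{\<mu>. integer_partition \<mu> \<and> sum_list \<mu> \<le> n} \<subseteq> {\<mu>. set \<mu> \<subseteq> {..n} \<and> length \<mu> \<le> n}"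
    unfolding integer_partition_def using member_le_sum_list by fastforce
qed (rule finite_lists_length_le, simp)

lemma finite_partitions_of: "finite (partitions_of n)"
  by (rule finite_subset[OF _ finite_partitions_le[of n]]) (auto simp: partitions_of_def)

lemma partitions_of_0: "partitions_of 0 = {[]}"
proof -
  have "\<mu> = []" if "0 \<notin> set \<mu>" "sum_list \<mu> = 0" for \<mu> :: "nat list"
    using that by (cases \<mu>) auto
  then show ?thesis by (auto simp: partitions_of_def integer_partition_def)
qed

lemma finite_standard_young_tableaux: "finite (standard_young_tableaux \<mu>)"
proof (rule finite_subset)
  show "standard_young_tableaux \<mu> \<subseteq> PiE (young_diagram \<mu>) (\<lambda>_. {1..sum_list \<mu>})"
    by (auto simp: standard_young_tableaux_def PiE_def bij_betw_def)
qed (intro finite_PiE; simp)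

lemma num_syt_Nil: "num_syt [] = 1"
proof -
  have "standard_young_tableaux [] = {\<lambda>_. undefined}"
    by (auto simp: standard_young_tableaux_def bij_betw_def)
  then show ?thesis by (simp add: num_syt_def)
qed

lemma num_involutions_0: "num_involutions 0 = 1"
proof -
  have "{\<sigma>. \<sigma> permutes {1..0::nat} \<and> \<sigma> \<circ> \<sigma> = id} = {id}" by auto
  then show ?thesis by (simp add: num_involutions_def)
qed

lemma lvt_size_le:
  assumes v: "v \<in> limiting_vacillating_tableaux k \<mu>" and "i < 2 * k + 2"
  shows "sum_list (v ! i) \<le> i"
  using \<open>i < 2 * k + 2\<close>
proof (induction i)
  case 0
  then show ?case using v by (simp add: limiting_vacillating_tableaux_def)
next
  case (Suc i)
  have IH: "card (young_diagram (v ! i)) \<le> i"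
    using Suc by (simp add: card_young_diagram)
  show ?case
  proof (cases "even i")
    case True
    then obtain j where j: "i = 2 * j" by blast
    then have "young_diagram (v ! Suc i) \<subseteq> young_diagram (v ! i)"
      using v Suc.prems by (auto simp: limiting_vacillating_tableaux_def)
    from card_mono[OF finite_young_diagram this] IH show ?thesis
      by (simp add: card_young_diagram)
  next
    case False
    then obtain j where j: "i = 2 * j + 1" by (elim oddE)
    then have "young_diagram (v ! i) \<subseteq> young_diagram (v ! Suc i)"
      "card (young_diagram (v ! Suc i) - young_diagram (v ! i)) = 1"
      using v Suc.prems by (auto simp: limiting_vacillating_tableaux_def)
    then have "card (young_diagram (v ! Suc i)) = card (young_diagram (v ! i)) + 1"
      by (metis card_Diff_subset card_mono finite_young_diagram le_add_diff_inverse)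
    with IH show ?thesis by (simp add: card_young_diagram)
  qed
qed

lemma finite_lvt: "finite (limiting_vacillating_tableaux k \<mu>)"
proof (rule finite_subset)
  let ?P = "{\<nu>. integer_partition \<nu> \<and> sum_list \<nu> \<le> 2 * k + 2}"
  show "limiting_vacillating_tableaux k \<mu> \<subseteq> {v. set v \<subseteq> ?P \<and> length v = 2 * k + 2}"
  proof
    fix v assume v: "v \<in> limiting_vacillating_tableaux k \<mu>"
    then have len: "length v = 2 * k + 2" and "\<forall>\<nu> \<in> set v. integer_partition \<nu>"
      by (simp_all add: limiting_vacillating_tableaux_def)
    moreover have "sum_list \<nu> \<le> 2 * k + 2" if "\<nu> \<in> set v" for \<nu>
    proof -
      from that len obtain i where "i < 2 * k + 2" "\<nu> = v ! i"
        by (auto simp: in_set_conv_nth)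
      then show ?thesis using lvt_size_le[OF v, of i] by simp
    qed
    ultimately show "v \<in> {v. set v \<subseteq> ?P \<and> length v = 2 * k + 2}" by auto
  qed
qed (rule finite_lists_length_eq, rule finite_partitions_le)

lemma finite_num_lvt_support: "finite {\<mu>. num_lvt k \<mu> \<noteq> 0}"
proof (rule finite_subset)
  show "{\<mu>. num_lvt k \<mu> \<noteq> 0} \<subseteq> {\<mu>. integer_partition \<mu> \<and> sum_list \<mu> \<le> 2 * k + 1}"
  proof
    fix \<mu> assume "\<mu> \<in> {\<mu>. num_lvt k \<mu> \<noteq> 0}"
    then obtain v where v: "v \<in> limiting_vacillating_tableaux k \<mu>"
      by (auto simp: num_lvt_def card_eq_0_iff)
    then have "\<mu> \<in> set v" "v ! (2 * k + 1) = \<mu>" "\<forall>\<nu> \<in> set v. integer_partition \<nu>"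
      by (auto simp: limiting_vacillating_tableaux_def in_set_conv_nth)
    then show "\<mu> \<in> {\<mu>. integer_partition \<mu> \<and> sum_list \<mu> \<le> 2 * k + 1}"
      using lvt_size_le[OF v, of "2 * k + 1"] by auto
  qed
qed (rule finite_partitions_le)

end

theory Submission
  imports Defs
begin

text \<open>
  Young's lattice, the set of integer partitions ordered by containment of diagrams, is a
  differential poset. Let \<open>U\<close> and \<open>D\<close> be the operators on integer combinations of partitions that
  send a partition to the sum of its upper covers and of its lower covers. Then \<open>D U - U D = 1\<close>
  (\<open>up_down_commutation\<close>): two distinct partitions with a common upper cover have a unique common
  lower cover, and conversely, while every partition has exactly one more upper than lower cover.
  As \<open>D\<close> kills the empty partition \<open>\<emptyset>\<close>, it follows that \<open>D U\<^sup>n \<emptyset> = n U\<^sup>n\<^sup>-\<^sup>1 \<emptyset>\<close>.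

  A standard Young tableau is a path from \<open>\<emptyset>\<close> upwards, so \<open>f\<^sup>\<mu>\<close> is the coefficient of \<open>\<mu>\<close> in
  \<open>U\<^sup>n \<emptyset>\<close> for \<open>n = |\<mu>|\<close> (\<open>num_syt_branching\<close>). Limiting vacillating tableaux are the paths
  counted by \<open>(1 + D) (U (1 + D))\<^sup>k \<emptyset>\<close>. Since
  \<open>(1 + D) U (U\<^sup>n \<emptyset>) = U\<^sup>n\<^sup>+\<^sup>1 \<emptyset> + (n + 1) U\<^sup>n \<emptyset>\<close>, the coefficient of \<open>U\<^sup>n \<emptyset>\<close> in this vector
  obeys the recurrence of the Stirling numbers of the second kind. This yields more than the
  theorem asks for: the number of tableaux of each single shape \<open>\<mu>\<close> is
  \<open>S(k + 1, |\<mu>| + 1) f\<^sup>\<mu>\<close> (\<open>num_lvt_eq\<close>). The first equation of the theorem groups the shapes by size.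

  For the second equation let \<open>t\<^sub>n\<close> be the sum of \<open>f\<^sup>\<mu>\<close> over all \<open>\<mu>\<close> of size \<open>n\<close>, which is the
  coefficient sum of \<open>U\<^sup>n \<emptyset>\<close>. The surplus of one upper cover says that \<open>U\<close> and \<open>1 + D\<close> change
  coefficient sums in the same way, so \<open>t\<^sub>n\<^sub>+\<^sub>1 = t\<^sub>n + n t\<^sub>n\<^sub>-\<^sub>1\<close>. Involutions satisfy the same
  recurrence: a chosen point is either fixed or swapped with one of the \<open>n\<close> others.
\<close>

section \<open>Partitions as row-length functions\<close>

text \<open>
  Padding with zero rows makes union, intersection and growth of diagrams into the pointwise
  maximum, minimum and increment of functions, with no list lengths to track. The partitions
  correspond exactly to the antitone functions that reach zero.
\<close>

definition row_length :: "nat list \<Rightarrow> nat \<Rightarrow> nat" where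
  "row_length \<mu> r = (if r < length \<mu> then \<mu> ! r else 0)"

lemma young_diagram_row_length: "young_diagram \<mu> = {(r, c). c < row_length \<mu> r}"
  by (auto simp: young_diagram_def row_length_def split: if_splits)

lemma row_length_Suc_le: "integer_partition \<mu> \<Longrightarrow> row_length \<mu> (Suc r) \<le> row_length \<mu> r"
  unfolding integer_partition_def row_length_def by (auto simp: sorted_wrt_iff_nth_less)

lemma row_length_eq_0_iff:
  assumes "integer_partition \<mu>"
  shows "row_length \<mu> r = 0 \<longleftrightarrow> length \<mu> \<le> r"
  using assms nth_mem[of r \<mu>] unfolding integer_partition_def row_length_def
  by (metis linorder_not_less)

lemma row_length_inject:
  assumes "integer_partition \<mu>" "integer_partition \<nu>"
  shows "row_length \<mu> = row_length \<nu> \<longleftrightarrow> \<mu> = \<nu>"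
proof
  assume eq: "row_length \<mu> = row_length \<nu>"
  then have "length \<mu> \<le> r \<longleftrightarrow> length \<nu> \<le> r" for r
    using assms row_length_eq_0_iff by metis
  then have len: "length \<mu> = length \<nu>"
    by (metis order_antisym order_refl)
  show "\<mu> = \<nu>"
  proof (rule nth_equalityI[OF len])
    fix i assume "i < length \<mu>"
    with eq len show "\<mu> ! i = \<nu> ! i"
      by (metis row_length_def)
  qed
qed simp

lemma row_length_surj:
  fixes g :: "nat \<Rightarrow> nat"
  assumes step: "\<And>r. g (Suc r) \<le> g r" and zero: "g n = 0"
  obtains \<mu> where "integer_partition \<mu>" "row_length \<mu> = g"
proof
  define m where "m = (LEAST n. g n = 0)"
  have anti: "g j \<le> g i" if "i \<le> j" for i j
    using lift_Suc_antimono_le[of g, OF step that] .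
  have m: "g m = 0" unfolding m_def using zero by (rule LeastI)
  have pos: "g i \<noteq> 0" if "i < m" for i
    using not_less_Least that unfolding m_def by blast
  show "integer_partition (map g [0..<m])"
    by (auto simp: integer_partition_def sorted_wrt_iff_nth_less intro: anti dest: pos)
  have "g r = 0" if "m \<le> r" for r
    using anti[OF that] m by simp
  then show "row_length (map g [0..<m]) = g"
    by (auto simp: row_length_def)
qed

section \<open>The covering relation of Young's lattice\<close>

definition covered_by :: "nat list \<Rightarrow> nat list \<Rightarrow> bool" (infix "\<lessdot>" 50) where
  "\<mu> \<lessdot> \<rho> \<longleftrightarrow> integer_partition \<mu> \<and> integer_partition \<rho> \<and>
     (\<exists>r. row_length \<rho> = (row_length \<mu>)(r := Suc (row_length \<mu> r)))"

lemma covered_by_partition: "\<mu> \<lessdot> \<rho> \<Longrightarrow> integer_partition \<mu>" "\<mu> \<lessdot> \<rho> \<Longrightarrow> integer_partition \<rho>"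
  by (simp_all add: covered_by_def)

lemma covered_by_young_diagram:
  assumes "\<mu> \<lessdot> \<rho>"
  obtains a where "a \<notin> young_diagram \<mu>" "young_diagram \<rho> = insert a (young_diagram \<mu>)"
proof -
  obtain r where r: "row_length \<rho> = (row_length \<mu>)(r := Suc (row_length \<mu> r))"
    using assms by (auto simp: covered_by_def)
  show thesis
    by (rule that[of "(r, row_length \<mu> r)"])
      (auto simp: young_diagram_row_length r split: if_splits)
qed

lemma covered_by_sum_list: "\<mu> \<lessdot> \<rho> \<Longrightarrow> sum_list \<rho> = Suc (sum_list \<mu>)"
  by (metis covered_by_young_diagram card_young_diagram card_insert_disjoint finite_young_diagram)

text \<open>
  This connects the row description with the size conditions on the steps of a vacillating tableau.
\<close>

lemma covered_by_iff_young_diagram: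
  assumes "integer_partition \<mu>" "integer_partition \<rho>"
  shows "\<mu> \<lessdot> \<rho> \<longleftrightarrow> young_diagram \<mu> \<subseteq> young_diagram \<rho> \<and> card (young_diagram \<rho> - young_diagram \<mu>) = 1"
    (is "_ \<longleftrightarrow> ?R")
proof
  assume "\<mu> \<lessdot> \<rho>"
  then obtain a where "a \<notin> young_diagram \<mu>" "young_diagram \<rho> = insert a (young_diagram \<mu>)"
    by (rule covered_by_young_diagram)
  moreover from this have "young_diagram \<rho> - young_diagram \<mu> = {a}" by blast
  ultimately show ?R by auto
next
  assume R: ?R
  then obtain r c where rc: "young_diagram \<rho> - young_diagram \<mu> = {(r, c)}"
    by (metis card_1_singletonE surj_pair)
  with R have ins: "(i, j) \<in> young_diagram \<rho> \<longleftrightarrow> (i, j) \<in> young_diagram \<mu> \<or> (i = r \<and> j = c)" for i j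
    by auto
  have notin: "(r, c) \<notin> young_diagram \<mu>" using rc by auto
  have ins': "j < row_length \<rho> i \<longleftrightarrow> j < row_length \<mu> i \<or> (i = r \<and> j = c)" for i j
    using ins[of i j] by (simp add: young_diagram_row_length)
  have "row_length \<rho> i = row_length \<mu> i" if "i \<noteq> r" for i
    using ins'[of _ i] that by (metis linorder_neqE_nat less_irrefl)
  moreover have "row_length \<rho> r = Suc (row_length \<mu> r)"
  proof -
    have c: "row_length \<mu> r \<le> c" using notin by (simp add: young_diagram_row_length)
    show ?thesis
      using ins'[of c r] ins'[of "row_length \<mu> r" r] ins'[of "Suc (row_length \<mu> r)" r] c
      by auto
  qed
  ultimately have "row_length \<rho> = (row_length \<mu>)(r := Suc (row_length \<mu> r))" by auto
  then show "\<mu> \<lessdot> \<rho>" using assms by (auto simp: covered_by_def)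
qed

lemma finite_upper_covers: "finite {\<rho>. \<mu> \<lessdot> \<rho>}"
  by (rule finite_subset[OF _ finite_partitions_le[of "Suc (sum_list \<mu>)"]])
    (auto simp: covered_by_sum_list covered_by_partition)

lemma finite_lower_covers: "finite {\<mu>. \<mu> \<lessdot> \<rho>}"
  by (rule finite_subset[OF _ finite_partitions_le[of "sum_list \<rho>"]])
    (auto simp: covered_by_sum_list covered_by_partition)

section \<open>Young's lattice is a differential poset\<close>

definition addable_rows :: "nat list \<Rightarrow> nat set" where
  "addable_rows \<mu> = {r. r = 0 \<or> row_length \<mu> r < row_length \<mu> (r - 1)}"

definition removable_rows :: "nat list \<Rightarrow> nat set" where
  "removable_rows \<mu> = {r. row_length \<mu> (Suc r) < row_length \<mu> r}"

lemma add_cell: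
  assumes "integer_partition \<mu>" "r \<in> addable_rows \<mu>"
  obtains \<rho> where "\<mu> \<lessdot> \<rho>" "row_length \<rho> = (row_length \<mu>)(r := Suc (row_length \<mu> r))"
proof -
  let ?g = "(row_length \<mu>)(r := Suc (row_length \<mu> r))"
  have "?g (Suc i) \<le> ?g i" for i
    using row_length_Suc_le[OF assms(1), of i] assms(2)
    by (cases "r = Suc i") (auto simp: addable_rows_def)
  moreover have "?g (length \<mu> + Suc r) = 0" by (simp add: row_length_def)
  ultimately obtain \<rho> where "integer_partition \<rho>" "row_length \<rho> = ?g"
    by (rule row_length_surj)
  with assms(1) show thesis by (intro that[of \<rho>]) (auto simp: covered_by_def)
qed

lemma remove_cell:
  assumes "integer_partition \<mu>" "r \<in> removable_rows \<mu>"
  obtains \<kappa> where "\<kappa> \<lessdot> \<mu>" "row_length \<kappa> = (row_length \<mu>)(r := row_length \<mu> r - 1)"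
proof -
  let ?g = "(row_length \<mu>)(r := row_length \<mu> r - 1)"
  have "?g (Suc i) \<le> ?g i" for i
    using row_length_Suc_le[OF assms(1), of i] assms(2)
    by (auto simp: removable_rows_def)
  moreover have "?g (length \<mu> + Suc r) = 0" by (simp add: row_length_def)
  ultimately obtain \<kappa> where \<kappa>: "integer_partition \<kappa>" "row_length \<kappa> = ?g"
    by (rule row_length_surj)
  moreover have "row_length \<mu> = (row_length \<kappa>)(r := Suc (row_length \<kappa> r))"
    using assms(2) by (auto simp: \<kappa>(2) removable_rows_def)
  ultimately show thesis using assms(1) by (intro that[of \<kappa>]) (auto simp: covered_by_def)
qed

lemma card_upper_covers:
  assumes "integer_partition \<mu>"
  shows "card {\<rho>. \<mu> \<lessdot> \<rho>} = card (addable_rows \<mu>)"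
proof -
  let ?add = "\<lambda>r. (row_length \<mu>)(r := Suc (row_length \<mu> r))"
  have "row_length ` {\<rho>. \<mu> \<lessdot> \<rho>} = ?add ` addable_rows \<mu>"
  proof (intro equalityI subsetI)
    fix g assume "g \<in> row_length ` {\<rho>. \<mu> \<lessdot> \<rho>}"
    then obtain \<rho> r where l: "g = row_length \<rho>" "integer_partition \<rho>" "row_length \<rho> = ?add r"
      by (auto simp: covered_by_def)
    then have "r \<in> addable_rows \<mu>"
      using row_length_Suc_le[OF l(2), of "r - 1"] by (cases r) (auto simp: addable_rows_def)
    with l show "g \<in> ?add ` addable_rows \<mu>" by auto
  next
    fix g assume "g \<in> ?add ` addable_rows \<mu>"
    then obtain r where r: "r \<in> addable_rows \<mu>" "g = ?add r" by auto
    from assms r(1) obtain \<rho> where "\<mu> \<lessdot> \<rho>" "row_length \<rho> = ?add r" by (rule add_cell)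
    with r show "g \<in> row_length ` {\<rho>. \<mu> \<lessdot> \<rho>}" by (metis imageI mem_Collect_eq)
  qed
  moreover have "inj_on row_length {\<rho>. \<mu> \<lessdot> \<rho>}"
    by (auto simp: inj_on_def row_length_inject covered_by_partition)
  moreover have "inj_on ?add (addable_rows \<mu>)"
    by (rule inj_onI) (metis fun_upd_apply n_not_Suc_n)
  ultimately show ?thesis by (metis card_image)
qed

lemma card_lower_covers:
  assumes "integer_partition \<mu>"
  shows "card {\<kappa>. \<kappa> \<lessdot> \<mu>} = card (removable_rows \<mu>)"
proof -
  let ?del = "\<lambda>r. (row_length \<mu>)(r := row_length \<mu> r - 1)"
  have "row_length ` {\<kappa>. \<kappa> \<lessdot> \<mu>} = ?del ` removable_rows \<mu>"
  proof (intro equalityI subsetI)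
    fix g assume "g \<in> row_length ` {\<kappa>. \<kappa> \<lessdot> \<mu>}"
    then obtain \<kappa> r where l: "g = row_length \<kappa>" "integer_partition \<kappa>"
      "row_length \<mu> = (row_length \<kappa>)(r := Suc (row_length \<kappa> r))"
      by (auto simp: covered_by_def)
    then have "r \<in> removable_rows \<mu>" "g = ?del r"
      using row_length_Suc_le[OF l(2), of r] by (auto simp: removable_rows_def)
    then show "g \<in> ?del ` removable_rows \<mu>" by blast
  next
    fix g assume "g \<in> ?del ` removable_rows \<mu>"
    then obtain r where r: "r \<in> removable_rows \<mu>" "g = ?del r" by auto
    from assms r(1) obtain \<kappa> where "\<kappa> \<lessdot> \<mu>" "row_length \<kappa> = ?del r" by (rule remove_cell)
    with r show "g \<in> row_length ` {\<kappa>. \<kappa> \<lessdot> \<mu>}" by (metis imageI mem_Collect_eq)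
  qed
  moreover have "inj_on row_length {\<kappa>. \<kappa> \<lessdot> \<mu>}"
    by (auto simp: inj_on_def row_length_inject covered_by_partition)
  moreover have "inj_on ?del (removable_rows \<mu>)"
  proof (rule inj_onI)
    fix r s assume "r \<in> removable_rows \<mu>" "?del r = ?del s"
    then have "row_length \<mu> r > 0" "?del r r = ?del s r" by (auto simp: removable_rows_def)
    then show "r = s" by (auto split: if_splits)
  qed
  ultimately show ?thesis by (metis card_image)
qed

text \<open>
  A cell can be removed at the end of row \<open>r\<close> exactly if one can be added at the end of row
  \<open>r + 1\<close>, since both mean that row \<open>r + 1\<close> is the shorter one. Only row \<open>0\<close>, which can always
  grow, is not matched by this shift.
\<close>

lemma card_upper_covers_eq_Suc_lower:
  assumes "integer_partition \<mu>"
  shows "card {\<rho>. \<mu> \<lessdot> \<rho>} = Suc (card {\<kappa>. \<kappa> \<lessdot> \<mu>})"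
proof -
  have "addable_rows \<mu> = insert 0 (Suc ` removable_rows \<mu>)"
    by (auto simp: addable_rows_def removable_rows_def image_iff elim: not0_implies_Suc)
      (metis Suc_pred diff_Suc_1 gr0I)
  moreover have "removable_rows \<mu> \<subseteq> {..<length \<mu>}"
    by (auto simp: removable_rows_def row_length_def split: if_splits)
  then have "finite (removable_rows \<mu>)" by (rule finite_subset) simp
  ultimately show ?thesis
    using assms by (simp add: card_upper_covers card_lower_covers card_image card_insert_disjoint)
qed

text \<open>
  The partitions form a lattice under pointwise maximum and minimum of row lengths. A common upper
  cover of two distinct partitions must be their join, hence is unique; the cells that they add to
  reach it lie in different rows, so removing both gives the meet, which they cover. The next lemma
  is the dual.
\<close>

lemma common_upper_cover:
  assumes "\<mu> \<lessdot> \<rho>" "\<nu> \<lessdot> \<rho>" "\<mu> \<noteq> \<nu>"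
  shows "row_length \<rho> = (\<lambda>r. max (row_length \<mu> r) (row_length \<nu> r))"
    and "\<exists>\<kappa>. \<kappa> \<lessdot> \<mu> \<and> \<kappa> \<lessdot> \<nu>"
proof -
  note part = covered_by_partition[OF assms(1)] covered_by_partition[OF assms(2)]
  obtain i j where i: "row_length \<rho> = (row_length \<mu>)(i := Suc (row_length \<mu> i))"
    and j: "row_length \<rho> = (row_length \<nu>)(j := Suc (row_length \<nu> j))"
    using assms unfolding covered_by_def by blast
  have "row_length \<mu> \<noteq> row_length \<nu>" using assms part by (simp add: row_length_inject)
  then have "i \<noteq> j" using i j by (metis fun_upd_apply fun_upd_idem_iff fun_upd_upd nat.inject)
  have mu: "row_length \<mu> r = (if r = j then Suc (row_length \<nu> j) else
      if r = i then row_length \<nu> i - 1 else row_length \<nu> r)" for r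
    using fun_cong[OF i, of r] fun_cong[OF j, of r] \<open>i \<noteq> j\<close> by (auto split: if_splits)
  have pos: "row_length \<nu> i = Suc (row_length \<mu> i)"
    using fun_cong[OF i, of i] fun_cong[OF j, of i] \<open>i \<noteq> j\<close> by simp
  show "row_length \<rho> = (\<lambda>r. max (row_length \<mu> r) (row_length \<nu> r))"
    using mu pos by (auto simp: j fun_eq_iff)
  let ?g = "\<lambda>r. min (row_length \<mu> r) (row_length \<nu> r)"
  have "?g (Suc r) \<le> ?g r" for r
    using row_length_Suc_le[OF part(1), of r] row_length_Suc_le[OF part(3), of r] by linarith
  moreover have "?g (length \<mu>) = 0" by (simp add: row_length_def)
  ultimately obtain \<kappa> where k: "integer_partition \<kappa>" "row_length \<kappa> = ?g"
    by (rule row_length_surj)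
  have "row_length \<mu> = (row_length \<kappa>)(j := Suc (row_length \<kappa> j))"
    "row_length \<nu> = (row_length \<kappa>)(i := Suc (row_length \<kappa> i))"
    using mu pos \<open>i \<noteq> j\<close> by (auto simp: k(2) fun_eq_iff)
  then have "\<kappa> \<lessdot> \<mu>" "\<kappa> \<lessdot> \<nu>"
    using k(1) part unfolding covered_by_def by blast+
  then show "\<exists>\<kappa>. \<kappa> \<lessdot> \<mu> \<and> \<kappa> \<lessdot> \<nu>" by blast
qed

lemma common_lower_cover:
  assumes "\<kappa> \<lessdot> \<mu>" "\<kappa> \<lessdot> \<nu>" "\<mu> \<noteq> \<nu>"
  shows "row_length \<kappa> = (\<lambda>r. min (row_length \<mu> r) (row_length \<nu> r))"
    and "\<exists>\<rho>. \<mu> \<lessdot> \<rho> \<and> \<nu> \<lessdot> \<rho>"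
proof -
  note part = covered_by_partition[OF assms(1)] covered_by_partition[OF assms(2)]
  obtain i j where i: "row_length \<mu> = (row_length \<kappa>)(i := Suc (row_length \<kappa> i))"
    and j: "row_length \<nu> = (row_length \<kappa>)(j := Suc (row_length \<kappa> j))"
    using assms by (auto simp: covered_by_def)
  have "row_length \<mu> \<noteq> row_length \<nu>" using assms part by (simp add: row_length_inject)
  then have "i \<noteq> j" using i j by auto
  then show "row_length \<kappa> = (\<lambda>r. min (row_length \<mu> r) (row_length \<nu> r))"
    by (auto simp: i j fun_eq_iff)
  let ?g = "\<lambda>r. max (row_length \<mu> r) (row_length \<nu> r)"
  have "?g (Suc r) \<le> ?g r" for r
    using row_length_Suc_le[OF part(2), of r] row_length_Suc_le[OF part(4), of r] by linarith
  moreover have "?g (max (length \<mu>) (length \<nu>)) = 0" by (simp add: row_length_def)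
  ultimately obtain \<rho> where l: "integer_partition \<rho>" "row_length \<rho> = ?g"
    by (rule row_length_surj)
  have "row_length \<rho> = (row_length \<mu>)(j := Suc (row_length \<mu> j))"
    "row_length \<rho> = (row_length \<nu>)(i := Suc (row_length \<nu> i))"
    using \<open>i \<noteq> j\<close> by (auto simp: l(2) i j fun_eq_iff)
  then have "\<mu> \<lessdot> \<rho>" "\<nu> \<lessdot> \<rho>"
    using l(1) part unfolding covered_by_def by blast+
  then show "\<exists>\<rho>. \<mu> \<lessdot> \<rho> \<and> \<nu> \<lessdot> \<rho>" by blast
qed

text \<open>
  This is \<open>D U = 1 + U D\<close>, with the operators applied to an arbitrary weight \<open>f\<close>. Paths that go up
  and then down and end at \<open>\<nu> \<noteq> \<mu>\<close> are determined by \<open>\<nu>\<close>, and so are those that go down and then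
  up; both kinds exist for the same \<open>\<nu>\<close>. Paths returning to \<open>\<mu>\<close> are counted by upper and by lower
  covers, and there the excess of one arises.
\<close>

lemma up_down_commutation:
  fixes f :: "nat list \<Rightarrow> nat"
  assumes \<mu>: "integer_partition \<mu>"
  shows "(\<Sum>\<rho> | \<mu> \<lessdot> \<rho>. \<Sum>\<nu> | \<nu> \<lessdot> \<rho>. f \<nu>) = f \<mu> + (\<Sum>\<kappa> | \<kappa> \<lessdot> \<mu>. \<Sum>\<nu> | \<kappa> \<lessdot> \<nu>. f \<nu>)"
proof -
  define UD where "UD = (SIGMA \<rho>:{\<rho>. \<mu> \<lessdot> \<rho>}. {\<nu>. \<nu> \<lessdot> \<rho> \<and> \<nu> \<noteq> \<mu>})"
  define DU where "DU = (SIGMA \<kappa>:{\<kappa>. \<kappa> \<lessdot> \<mu>}. {\<nu>. \<kappa> \<lessdot> \<nu> \<and> \<nu> \<noteq> \<mu>})"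
  have split_UD: "(\<Sum>\<nu> | \<nu> \<lessdot> \<rho>. f \<nu>) = f \<mu> + (\<Sum>\<nu> | \<nu> \<lessdot> \<rho> \<and> \<nu> \<noteq> \<mu>. f \<nu>)" if "\<mu> \<lessdot> \<rho>" for \<rho>
  proof -
    have "{\<nu>. \<nu> \<lessdot> \<rho> \<and> \<nu> \<noteq> \<mu>} = {\<nu>. \<nu> \<lessdot> \<rho>} - {\<mu>}" by auto
    with that show ?thesis by (simp add: sum.remove[OF finite_lower_covers])
  qed
  have split_DU: "(\<Sum>\<nu> | \<kappa> \<lessdot> \<nu>. f \<nu>) = f \<mu> + (\<Sum>\<nu> | \<kappa> \<lessdot> \<nu> \<and> \<nu> \<noteq> \<mu>. f \<nu>)" if "\<kappa> \<lessdot> \<mu>" for \<kappa>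
  proof -
    have "{\<nu>. \<kappa> \<lessdot> \<nu> \<and> \<nu> \<noteq> \<mu>} = {\<nu>. \<kappa> \<lessdot> \<nu>} - {\<mu>}" by auto
    with that show ?thesis by (simp add: sum.remove[OF finite_upper_covers])
  qed
  have "inj_on snd UD"
  proof (rule inj_onI)
    fix x y assume "x \<in> UD" "y \<in> UD" "snd x = snd y"
    then obtain \<rho> \<rho>' \<nu> where "x = (\<rho>, \<nu>)" "y = (\<rho>', \<nu>)" "\<mu> \<lessdot> \<rho>" "\<nu> \<lessdot> \<rho>" "\<mu> \<lessdot> \<rho>'" "\<nu> \<lessdot> \<rho>'" "\<mu> \<noteq> \<nu>"
      by (auto simp: UD_def)
    moreover from this have "row_length \<rho> = row_length \<rho>'"
      using common_upper_cover(1) by metis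
    ultimately show "x = y" by (simp add: row_length_inject covered_by_partition)
  qed
  moreover have "inj_on snd DU"
  proof (rule inj_onI)
    fix x y assume "x \<in> DU" "y \<in> DU" "snd x = snd y"
    then obtain \<kappa> \<kappa>' \<nu> where "x = (\<kappa>, \<nu>)" "y = (\<kappa>', \<nu>)" "\<kappa> \<lessdot> \<mu>" "\<kappa> \<lessdot> \<nu>" "\<kappa>' \<lessdot> \<mu>" "\<kappa>' \<lessdot> \<nu>" "\<mu> \<noteq> \<nu>"
      by (auto simp: DU_def)
    moreover from this have "row_length \<kappa> = row_length \<kappa>'"
      using common_lower_cover(1) by metis
    ultimately show "x = y" by (simp add: row_length_inject covered_by_partition)
  qed
  moreover have "snd ` UD = snd ` DU"
  proof -
    have "snd ` UD = {\<nu>. \<nu> \<noteq> \<mu> \<and> (\<exists>\<rho>. \<mu> \<lessdot> \<rho> \<and> \<nu> \<lessdot> \<rho>)}"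
      by (force simp: UD_def)
    also have "\<dots> = {\<nu>. \<nu> \<noteq> \<mu> \<and> (\<exists>\<kappa>. \<kappa> \<lessdot> \<mu> \<and> \<kappa> \<lessdot> \<nu>)}"
      using common_upper_cover(2) common_lower_cover(2) by blast
    also have "\<dots> = snd ` DU" by (force simp: DU_def)
    finally show ?thesis .
  qed
  ultimately have "(\<Sum>x\<in>UD. f (snd x)) = (\<Sum>x\<in>DU. f (snd x))"
    by (metis (no_types, lifting) comp_apply sum.cong sum.reindex)
  then have off_diagonal: "(\<Sum>\<rho> | \<mu> \<lessdot> \<rho>. \<Sum>\<nu> | \<nu> \<lessdot> \<rho> \<and> \<nu> \<noteq> \<mu>. f \<nu>) = (\<Sum>\<kappa> | \<kappa> \<lessdot> \<mu>. \<Sum>\<nu> | \<kappa> \<lessdot> \<nu> \<and> \<nu> \<noteq> \<mu>. f \<nu>)"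
    unfolding UD_def DU_def
    by (subst (1 2) sum.Sigma)
      (auto simp: finite_upper_covers finite_lower_covers case_prod_unfold)
  show ?thesis
    using off_diagonal card_upper_covers_eq_Suc_lower[OF \<mu>]
    by (simp add: split_UD split_DU sum.distrib)
qed

section \<open>Counting standard Young tableaux\<close>

text \<open>
  The image condition says that the largest entry sits in the one cell outside \<open>\<mu>\<close>; such a
  tableau carries no more information than its restriction to \<open>\<mu>\<close>.
\<close>

lemma card_tableaux_extending:
  assumes "\<mu> \<lessdot> \<rho>"
  shows "card {t \<in> standard_young_tableaux \<rho>. t ` young_diagram \<mu> = {1..sum_list \<mu>}} = num_syt \<mu>"
proof -
  obtain a where a: "a \<notin> young_diagram \<mu>" and ins: "young_diagram \<rho> = insert a (young_diagram \<mu>)"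
    using assms by (rule covered_by_young_diagram)
  let ?n = "sum_list \<mu>"
  let ?F = "{t \<in> standard_young_tableaux \<rho>. t ` young_diagram \<mu> = {1..?n}}"
  have size: "sum_list \<rho> = Suc ?n" using assms by (rule covered_by_sum_list)
  have left: "(r, c) \<in> young_diagram \<nu>" if "(r, Suc c) \<in> young_diagram \<nu>" for r c \<nu>
    using that by (simp add: young_diagram_row_length)
  have above: "(r, c) \<in> young_diagram \<nu>" if "(Suc r, c) \<in> young_diagram \<nu>" "integer_partition \<nu>" for r c \<nu>
    using that row_length_Suc_le[of \<nu> r] by (simp add: young_diagram_row_length)
  note above_\<mu> = above[OF _ covered_by_partition(1)[OF assms]]
  note above_\<rho> = above[OF _ covered_by_partition(2)[OF assms]]
  have "bij_betw (\<lambda>t. restrict t (young_diagram \<mu>)) ?F (standard_young_tableaux \<mu>)"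
  proof (rule bij_betw_byWitness[where f' = "\<lambda>s. s(a := Suc ?n)"])
    show "\<forall>t\<in>?F. (restrict t (young_diagram \<mu>))(a := Suc ?n) = t"
    proof
      fix t assume t: "t \<in> ?F"
      then have inj: "inj_on t (young_diagram \<rho>)" and img: "t ` young_diagram \<rho> = {1..Suc ?n}"
        and img': "t ` young_diagram \<mu> = {1..?n}" and ext: "t \<in> extensional (young_diagram \<rho>)"
        by (auto simp: standard_young_tableaux_def bij_betw_def size)
      have "t a \<in> {1..Suc ?n}" using img ins by auto
      moreover have "t a \<notin> t ` young_diagram \<mu>"
        using inj a by (auto simp: ins inj_on_def)
      ultimately have "t a = Suc ?n" using img' by auto
      with ext show "(restrict t (young_diagram \<mu>))(a := Suc ?n) = t"
        by (auto simp: fun_eq_iff extensional_def ins)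
    qed
    show "\<forall>s\<in>standard_young_tableaux \<mu>. restrict (s(a := Suc ?n)) (young_diagram \<mu>) = s"
      using a by (auto simp: standard_young_tableaux_def fun_eq_iff extensional_def)
    show "(\<lambda>t. restrict t (young_diagram \<mu>)) ` ?F \<subseteq> standard_young_tableaux \<mu>"
    proof (rule image_subsetI)
      fix t assume t: "t \<in> ?F"
      then have "inj_on t (young_diagram \<mu>)"
        by (auto simp: standard_young_tableaux_def bij_betw_def ins)
      then have "bij_betw (restrict t (young_diagram \<mu>)) (young_diagram \<mu>) {1..?n}"
        using t by (auto simp: bij_betw_def inj_on_def)
      moreover have "restrict t (young_diagram \<mu>) (r, c) < restrict t (young_diagram \<mu>) (r, Suc c)"
        if "(r, Suc c) \<in> young_diagram \<mu>" for r c
        using t that left[OF that] by (simp add: standard_young_tableaux_def ins)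
      moreover have "restrict t (young_diagram \<mu>) (r, c) < restrict t (young_diagram \<mu>) (Suc r, c)"
        if "(Suc r, c) \<in> young_diagram \<mu>" for r c
        using t that above_\<mu>[OF that] by (simp add: standard_young_tableaux_def ins)
      ultimately show "restrict t (young_diagram \<mu>) \<in> standard_young_tableaux \<mu>"
        by (simp add: standard_young_tableaux_def)
    qed
    show "(\<lambda>s. s(a := Suc ?n)) ` standard_young_tableaux \<mu> \<subseteq> ?F"
    proof (rule image_subsetI)
      fix s assume s: "s \<in> standard_young_tableaux \<mu>"
      let ?t = "s(a := Suc ?n)"
      have bij: "bij_betw s (young_diagram \<mu>) {1..?n}"
        using s by (simp add: standard_young_tableaux_def)
      have img: "?t ` young_diagram \<mu> = {1..?n}"
        using bij a by (auto simp: bij_betw_def)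
      have le: "s x < Suc ?n" if "x \<in> young_diagram \<mu>" for x
        using bij_betwE[OF bij] that by (simp add: less_Suc_eq_le)
      have "inj_on ?t (young_diagram \<mu>)"
        using bij a by (auto simp: bij_betw_def inj_on_def)
      then have "inj_on ?t (young_diagram \<rho>)"
        using a img by (simp add: ins)
      moreover have "?t ` young_diagram \<rho> = {1..Suc ?n}"
        unfolding ins image_insert img by auto
      ultimately have "bij_betw ?t (young_diagram \<rho>) {1..Suc ?n}"
        by (simp add: bij_betw_def)
      moreover have "?t (r, c) < ?t (r, Suc c)" if "(r, Suc c) \<in> young_diagram \<rho>" for r c
      proof (cases "(r, Suc c) = a")
        case True
        then have "(r, c) \<in> young_diagram \<mu>" using left[OF that] by (auto simp: ins)
        with True show ?thesis using le by auto
      next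
        case False
        then have "(r, Suc c) \<in> young_diagram \<mu>" using that by (auto simp: ins)
        with left[OF this] False a s show ?thesis by (auto simp: standard_young_tableaux_def)
      qed
      moreover have "?t (r, c) < ?t (Suc r, c)" if "(Suc r, c) \<in> young_diagram \<rho>" for r c
      proof (cases "(Suc r, c) = a")
        case True
        then have "(r, c) \<in> young_diagram \<mu>" using above_\<rho>[OF that] by (auto simp: ins)
        with True show ?thesis using le by auto
      next
        case False
        then have "(Suc r, c) \<in> young_diagram \<mu>" using that by (auto simp: ins)
        with above_\<mu>[OF this] False a s show ?thesis by (auto simp: standard_young_tableaux_def)
      qed
      moreover have "?t \<in> extensional (young_diagram \<rho>)"
        using s by (auto simp: standard_young_tableaux_def extensional_def ins)
      ultimately show "?t \<in> ?F"
        using img by (simp add: standard_young_tableaux_def size)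
    qed
  qed
  then show ?thesis unfolding num_syt_def by (rule bij_betw_same_card)
qed

text \<open>
  Entries grow along rows and columns, so the cell with the largest entry is a corner of the diagram
  and removing it leaves a partition.
\<close>

lemma tableau_removes_to_cover:
  assumes \<rho>: "integer_partition \<rho>" "sum_list \<rho> = Suc n" and t: "t \<in> standard_young_tableaux \<rho>"
  obtains \<mu> where "\<mu> \<lessdot> \<rho>" "t ` young_diagram \<mu> = {1..n}"
proof -
  have bij: "bij_betw t (young_diagram \<rho>) {1..Suc n}"
    and right: "\<And>r c. (r, Suc c) \<in> young_diagram \<rho> \<Longrightarrow> t (r, c) < t (r, Suc c)"
    and down: "\<And>r c. (Suc r, c) \<in> young_diagram \<rho> \<Longrightarrow> t (r, c) < t (Suc r, c)"
    using t by (auto simp: standard_young_tableaux_def \<rho>(2))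
  have le: "t x \<le> Suc n" if "x \<in> young_diagram \<rho>" for x
    using bij that by (auto simp: bij_betw_def)
  have "Suc n \<in> t ` young_diagram \<rho>" using bij by (auto simp: bij_betw_def)
  then obtain r c where rc: "(r, c) \<in> young_diagram \<rho>" "t (r, c) = Suc n" by force
  have "(r, Suc c) \<notin> young_diagram \<rho>" "(Suc r, c) \<notin> young_diagram \<rho>"
    using right[of r c] down[of r c] le rc by fastforce+
  with rc have c: "c < row_length \<rho> r" "\<not> Suc c < row_length \<rho> r" "\<not> c < row_length \<rho> (Suc r)"
    by (auto simp: young_diagram_row_length)
  then have "r \<in> removable_rows \<rho>" by (auto simp: removable_rows_def)
  with \<rho>(1) obtain \<mu> where \<mu>: "\<mu> \<lessdot> \<rho>" "row_length \<mu> = (row_length \<rho>)(r := row_length \<rho> r - 1)"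
    by (rule remove_cell)
  have "young_diagram \<mu> = young_diagram \<rho> - {(r, c)}"
    using c by (auto simp: young_diagram_row_length \<mu>(2) split: if_splits)
  moreover have "t ` (young_diagram \<rho> - {(r, c)}) = t ` young_diagram \<rho> - t ` {(r, c)}"
    using bij rc by (intro inj_on_image_set_diff[of t "young_diagram \<rho>"]) (auto simp: bij_betw_def)
  ultimately have "t ` young_diagram \<mu> = t ` young_diagram \<rho> - {Suc n}"
    using rc by simp
  also have "\<dots> = {1..n}" using bij by (auto simp: bij_betw_def)
  finally show thesis using \<mu>(1) by (rule that[rotated])
qed

lemma num_syt_branching:
  assumes "integer_partition \<rho>" "\<rho> \<noteq> []"
  shows "num_syt \<rho> = (\<Sum>\<mu> | \<mu> \<lessdot> \<rho>. num_syt \<mu>)"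
proof -
  have "sum_list \<rho> \<noteq> 0"
    using assms partitions_of_0 by (auto simp: partitions_of_def)
  then obtain n where n: "sum_list \<rho> = Suc n" by (meson not0_implies_Suc)
  then have size: "sum_list \<mu> = n" if "\<mu> \<lessdot> \<rho>" for \<mu>
    using covered_by_sum_list[OF that] by simp
  define F where "F \<mu> = {t \<in> standard_young_tableaux \<rho>. t ` young_diagram \<mu> = {1..n}}" for \<mu>
  have "standard_young_tableaux \<rho> = (\<Union>\<mu>\<in>{\<mu>. \<mu> \<lessdot> \<rho>}. F \<mu>)"
  proof (intro equalityI subsetI)
    fix t assume t: "t \<in> standard_young_tableaux \<rho>"
    with assms(1) n obtain \<mu> where "\<mu> \<lessdot> \<rho>" "t ` young_diagram \<mu> = {1..n}"
      by (rule tableau_removes_to_cover)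
    with t show "t \<in> (\<Union>\<mu>\<in>{\<mu>. \<mu> \<lessdot> \<rho>}. F \<mu>)" unfolding F_def by blast
  qed (auto simp: F_def)
  then have "num_syt \<rho> = card (\<Union>\<mu>\<in>{\<mu>. \<mu> \<lessdot> \<rho>}. F \<mu>)"
    by (simp add: num_syt_def)
  also have "\<dots> = (\<Sum>\<mu> | \<mu> \<lessdot> \<rho>. card (F \<mu>))"
  proof (rule card_UN_disjoint)
    show "\<forall>\<mu>\<in>{\<mu>. \<mu> \<lessdot> \<rho>}. finite (F \<mu>)"
      using finite_standard_young_tableaux by (auto simp: F_def)
    show "\<forall>\<mu>\<in>{\<mu>. \<mu> \<lessdot> \<rho>}. \<forall>\<nu>\<in>{\<mu>. \<mu> \<lessdot> \<rho>}. \<mu> \<noteq> \<nu> \<longrightarrow> F \<mu> \<inter> F \<nu> = {}"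
    proof (intro ballI impI, rule ccontr)
      fix \<mu> \<nu> assume c: "\<mu> \<in> {\<mu>. \<mu> \<lessdot> \<rho>}" "\<nu> \<in> {\<mu>. \<mu> \<lessdot> \<rho>}" and "\<mu> \<noteq> \<nu>" "F \<mu> \<inter> F \<nu> \<noteq> {}"
      then obtain t where "t \<in> F \<mu>" "t \<in> F \<nu>" by blast
      then have "inj_on t (young_diagram \<rho>)" "t ` young_diagram \<mu> = t ` young_diagram \<nu>"
        by (auto simp: F_def standard_young_tableaux_def bij_betw_def)
      moreover have "young_diagram \<mu> \<subseteq> young_diagram \<rho>" "young_diagram \<nu> \<subseteq> young_diagram \<rho>"
        using c by (auto elim: covered_by_young_diagram)
      ultimately have "young_diagram \<mu> = young_diagram \<nu>"
        by (simp add: inj_on_image_eq_iff)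
      then have "c < row_length \<mu> r \<longleftrightarrow> c < row_length \<nu> r" for r c
        by (auto simp: young_diagram_row_length set_eq_iff)
      then have "row_length \<mu> = row_length \<nu>"
        by (metis ext less_irrefl linorder_neqE_nat)
      with c \<open>\<mu> \<noteq> \<nu>\<close> show False by (simp add: row_length_inject covered_by_partition)
    qed
  qed (rule finite_lower_covers)
  also have "\<dots> = (\<Sum>\<mu> | \<mu> \<lessdot> \<rho>. num_syt \<mu>)"
    using card_tableaux_extending size by (auto simp: F_def intro!: sum.cong)
  finally show ?thesis .
qed

lemma not_covered_by_Nil: "\<not> \<mu> \<lessdot> []"
  using covered_by_sum_list by force

text \<open>
  The coefficient form of \<open>D U\<^sup>n\<^sup>+\<^sup>1 \<emptyset> = (n + 1) U\<^sup>n \<emptyset>\<close>: expand each \<open>f\<^sup>\<rho>\<close> by the branching rule,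
  commute, and apply the induction hypothesis to the lower covers of \<open>\<mu>\<close>.
\<close>

lemma sum_num_syt_upper_covers:
  assumes "integer_partition \<mu>"
  shows "(\<Sum>\<rho> | \<mu> \<lessdot> \<rho>. num_syt \<rho>) = Suc (sum_list \<mu>) * num_syt \<mu>"
  using assms
proof (induction "sum_list \<mu>" arbitrary: \<mu> rule: less_induct)
  case less
  have "(\<Sum>\<rho> | \<mu> \<lessdot> \<rho>. num_syt \<rho>) = (\<Sum>\<rho> | \<mu> \<lessdot> \<rho>. \<Sum>\<nu> | \<nu> \<lessdot> \<rho>. num_syt \<nu>)"
    using not_covered_by_Nil
    by (intro sum.cong refl num_syt_branching) (auto simp: covered_by_partition)
  also have "\<dots> = num_syt \<mu> + (\<Sum>\<kappa> | \<kappa> \<lessdot> \<mu>. \<Sum>\<nu> | \<kappa> \<lessdot> \<nu>. num_syt \<nu>)"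
    using less.prems by (rule up_down_commutation)
  also have "(\<Sum>\<kappa> | \<kappa> \<lessdot> \<mu>. \<Sum>\<nu> | \<kappa> \<lessdot> \<nu>. num_syt \<nu>) = (\<Sum>\<kappa> | \<kappa> \<lessdot> \<mu>. sum_list \<mu> * num_syt \<kappa>)"
    using less.hyps by (intro sum.cong refl) (simp add: covered_by_sum_list covered_by_partition)
  also have "\<dots> = sum_list \<mu> * num_syt \<mu>"
    using num_syt_branching[OF less.prems]
    by (cases "\<mu> = []") (simp_all add: sum_distrib_left[symmetric] not_covered_by_Nil)
  finally show ?case by simp
qed

section \<open>Counting limiting vacillating tableaux\<close>

lemma limiting_vacillating_tableaux_0:
  assumes "integer_partition \<mu>"
  shows "limiting_vacillating_tableaux 0 \<mu> = (if \<mu> = [] then {[[], []]} else {})"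
proof -
  have "\<mu> = []" if "young_diagram \<mu> = {}"
    using that assms card_young_diagram[of \<mu>] partitions_of_0 by (auto simp: partitions_of_def)
  moreover have "v = [[], []]" if "length v = 2" "v ! 0 = []" "v ! Suc 0 = []" for v :: "nat list list"
    using that by (auto simp: length_Suc_conv numeral_2_eq_2)
  ultimately show ?thesis
    by (auto simp: limiting_vacillating_tableaux_def integer_partition_def)
qed

text \<open>
  A tableau for \<open>k + 1\<close> extends one for \<open>k\<close> of some shape \<open>\<nu>\<close> by a step up to \<open>\<rho>\<close>
  and a step that either stays at \<open>\<rho>\<close> or goes down to a lower cover.
\<close>

lemma limiting_vacillating_tableaux_Suc:
  assumes \<mu>: "integer_partition \<mu>"
  shows "limiting_vacillating_tableaux (Suc k) \<mu> =
    (\<lambda>(\<rho>, \<nu>, w). w @ [\<rho>, \<mu>]) `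
      (SIGMA \<rho>:insert \<mu> {\<rho>. \<mu> \<lessdot> \<rho>}. SIGMA \<nu>:{\<nu>. \<nu> \<lessdot> \<rho>}. limiting_vacillating_tableaux k \<nu>)"
    (is "?L = ?f ` ?S")
proof (intro equalityI subsetI)
  fix v assume v: "v \<in> ?L"
  then have len: "length v = 2 * k + 4" and parts: "\<forall>\<nu> \<in> set v. integer_partition \<nu>"
    and v0: "v ! 0 = []" and vl: "v ! (2 * k + 3) = \<mu>"
    and down: "\<And>j. j \<le> Suc k \<Longrightarrow> young_diagram (v ! (2 * j + 1)) \<subseteq> young_diagram (v ! (2 * j)) \<and>
               card (young_diagram (v ! (2 * j)) - young_diagram (v ! (2 * j + 1))) \<in> {0, 1}"
    and up: "\<And>j. j < Suc k \<Longrightarrow> young_diagram (v ! (2 * j + 1)) \<subseteq> young_diagram (v ! (2 * j + 2)) \<and>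
               card (young_diagram (v ! (2 * j + 2)) - young_diagram (v ! (2 * j + 1))) = 1"
    by (auto simp: limiting_vacillating_tableaux_def eval_nat_numeral)
  define w where "w = take (2 * k + 2) v"
  define \<rho> where "\<rho> = v ! (2 * k + 2)"
  define \<nu> where "\<nu> = v ! (2 * k + 1)"
  have nth_w: "w ! i = v ! i" if "i < 2 * k + 2" for i
    using that by (simp add: w_def)
  have "v = w @ [\<rho>, \<mu>]"
  proof (rule nth_equalityI)
    fix i assume i: "i < length v"
    consider "i < 2 * k + 2" | "i = 2 * k + 2" | "i = 2 * k + 3" using i len by linarith
    then show "v ! i = (w @ [\<rho>, \<mu>]) ! i"
      using len vl by cases (auto simp: w_def \<rho>_def nth_append)
  qed (simp add: w_def len)
  moreover have "w \<in> limiting_vacillating_tableaux k \<nu>"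
    using len parts v0 down up set_take_subset[of "2 * k + 2" v]
    by (auto simp: limiting_vacillating_tableaux_def nth_w \<nu>_def) (auto simp: w_def)
  moreover have part: "integer_partition \<rho>" "integer_partition \<nu>"
    using parts len by (auto simp: \<rho>_def \<nu>_def)
  moreover have "\<nu> \<lessdot> \<rho>"
    using up[of k] part by (simp add: covered_by_iff_young_diagram \<rho>_def \<nu>_def)
  moreover have "\<rho> = \<mu> \<or> \<mu> \<lessdot> \<rho>"
  proof (cases "card (young_diagram \<rho> - young_diagram \<mu>) = 1")
    case True
    then show ?thesis
      using down[of "Suc k"] vl part \<mu>
      by (simp add: covered_by_iff_young_diagram \<rho>_def eval_nat_numeral)
  next
    case False
    have "young_diagram \<rho> = young_diagram \<mu>"
      using down[of "Suc k"] vl False by (auto simp: \<rho>_def eval_nat_numeral)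
    then have "c < row_length \<rho> r \<longleftrightarrow> c < row_length \<mu> r" for r c
      by (auto simp: young_diagram_row_length set_eq_iff)
    then have "row_length \<rho> = row_length \<mu>"
      by (metis ext less_irrefl linorder_neqE_nat)
    then show ?thesis using \<mu> part by (simp add: row_length_inject)
  qed
  ultimately show "v \<in> ?f ` ?S" by force
next
  fix v assume "v \<in> ?f ` ?S"
  then obtain \<rho> \<nu> w where v: "v = w @ [\<rho>, \<mu>]" and w: "w \<in> limiting_vacillating_tableaux k \<nu>"
    and \<rho>: "\<rho> = \<mu> \<or> \<mu> \<lessdot> \<rho>" and \<nu>: "\<nu> \<lessdot> \<rho>"
    by auto
  note part = covered_by_partition[OF \<nu>]
  have len: "length w = 2 * k + 2" using w by (simp add: limiting_vacillating_tableaux_def)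
  have nth: "v ! i = w ! i" if "i < 2 * k + 2" for i
    using that len by (simp add: v nth_append)
  have v2: "v ! (2 * k + 2) = \<rho>" and v3: "v ! (2 * k + 3) = \<mu>"
    using len by (simp_all add: v nth_append)
  have v1: "v ! (2 * k + 1) = \<nu>"
    using w by (simp add: nth limiting_vacillating_tableaux_def)
  have "young_diagram (v ! (2 * j + 1)) \<subseteq> young_diagram (v ! (2 * j)) \<and>
    card (young_diagram (v ! (2 * j)) - young_diagram (v ! (2 * j + 1))) \<in> {0, 1}" if "j \<le> Suc k" for j
  proof (cases "j = Suc k")
    case True
    then have "v ! (2 * j) = \<rho>" "v ! (2 * j + 1) = \<mu>"
      using v2 v3 by (simp_all add: eval_nat_numeral)
    with \<rho> \<mu> part show ?thesis by (auto simp: covered_by_iff_young_diagram)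
  next
    case False
    with that have "j \<le> k" by simp
    then show ?thesis using w by (simp add: nth limiting_vacillating_tableaux_def)
  qed
  moreover have "young_diagram (v ! (2 * j + 1)) \<subseteq> young_diagram (v ! (2 * j + 2)) \<and>
    card (young_diagram (v ! (2 * j + 2)) - young_diagram (v ! (2 * j + 1))) = 1" if "j < Suc k" for j
  proof (cases "j = k")
    case True
    with v1 v2 \<nu> part show ?thesis by (simp add: covered_by_iff_young_diagram)
  next
    case False
    with that have "j < k" by simp
    then show ?thesis using w by (simp add: nth limiting_vacillating_tableaux_def)
  qed
  moreover have "v ! 0 = []" using w by (simp add: nth limiting_vacillating_tableaux_def)
  moreover have "\<forall>\<nu>\<in>set v. integer_partition \<nu>"
    using w \<mu> part by (auto simp: v limiting_vacillating_tableaux_def)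
  moreover have "length v = 2 * Suc k + 2" "v ! (2 * Suc k + 1) = \<mu>"
    using len v3 by (simp_all add: v eval_nat_numeral)
  ultimately show "v \<in> ?L"
    unfolding limiting_vacillating_tableaux_def by blast
qed

lemma num_lvt_Suc:
  assumes \<mu>: "integer_partition \<mu>"
  shows "num_lvt (Suc k) \<mu> =
    (\<Sum>\<nu> | \<nu> \<lessdot> \<mu>. num_lvt k \<nu>) + (\<Sum>\<rho> | \<mu> \<lessdot> \<rho>. \<Sum>\<nu> | \<nu> \<lessdot> \<rho>. num_lvt k \<nu>)"
proof -
  let ?S = "SIGMA \<rho>:insert \<mu> {\<rho>. \<mu> \<lessdot> \<rho>}. SIGMA \<nu>:{\<nu>. \<nu> \<lessdot> \<rho>}. limiting_vacillating_tableaux k \<nu>"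
  have "inj_on (\<lambda>(\<rho>, \<nu>, w). w @ [\<rho>, \<mu>]) ?S"
    by (auto simp: inj_on_def limiting_vacillating_tableaux_def)
  then have "num_lvt (Suc k) \<mu> = card ?S"
    unfolding num_lvt_def limiting_vacillating_tableaux_Suc[OF \<mu>] by (rule card_image)
  also have "\<dots> = (\<Sum>\<rho>\<in>insert \<mu> {\<rho>. \<mu> \<lessdot> \<rho>}. \<Sum>\<nu> | \<nu> \<lessdot> \<rho>. num_lvt k \<nu>)"
    by (simp add: card_SigmaI finite_upper_covers finite_lower_covers finite_lvt finite_SigmaI num_lvt_def
      del: sum.insert card_insert_disjoint)
  also have "\<mu> \<notin> {\<rho>. \<mu> \<lessdot> \<rho>}"
    using covered_by_sum_list by fastforce
  ultimately show ?thesis by (simp add: finite_upper_covers)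
qed

text \<open>
  In the recurrence \<open>num_lvt_Suc\<close> the tableaux that stay in the last step contribute
  \<open>S(k + 1, n) f\<^sup>\<mu>\<close> for \<open>n = |\<mu>|\<close> by the branching rule, and those that go down contribute
  \<open>(n + 1) S(k + 1, n + 1) f\<^sup>\<mu>\<close> by \<open>sum_num_syt_upper_covers\<close>. The two add up to \<open>S(k + 2, n + 1) f\<^sup>\<mu>\<close>.
\<close>

lemma num_lvt_eq:
  assumes "integer_partition \<mu>"
  shows "num_lvt k \<mu> = Stirling (k + 1) (sum_list \<mu> + 1) * num_syt \<mu>"
  using assms
proof (induction k arbitrary: \<mu>)
  case 0
  show ?case
  proof (cases "sum_list \<mu>")
    case 0
    then have "\<mu> = []"
      using \<open>integer_partition \<mu>\<close> partitions_of_0 by (auto simp: partitions_of_def)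
    then show ?thesis
      by (simp add: num_lvt_def limiting_vacillating_tableaux_0 num_syt_Nil integer_partition_def)
  next
    case (Suc m)
    then have "\<mu> \<noteq> []" by auto
    with \<open>integer_partition \<mu>\<close> Suc show ?thesis
      by (simp add: num_lvt_def limiting_vacillating_tableaux_0)
  qed
next
  case (Suc k)
  let ?n = "sum_list \<mu>"
  have "(\<Sum>\<nu> | \<nu> \<lessdot> \<mu>. num_lvt k \<nu>) = (\<Sum>\<nu> | \<nu> \<lessdot> \<mu>. Stirling (k + 1) ?n * num_syt \<nu>)"
    by (intro sum.cong refl) (simp add: Suc.IH covered_by_sum_list covered_by_partition)
  \<comment> \<open>the branching rule fails for the empty partition, but there \<open>S(k + 1, 0) = 0\<close>\<close>
  also have "\<dots> = Stirling (k + 1) ?n * num_syt \<mu>"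
    using num_syt_branching[OF Suc.prems]
    by (cases "\<mu> = []") (simp_all add: sum_distrib_left[symmetric] not_covered_by_Nil)
  finally have stay: "(\<Sum>\<nu> | \<nu> \<lessdot> \<mu>. num_lvt k \<nu>) = Stirling (k + 1) ?n * num_syt \<mu>" .
  have "(\<Sum>\<nu> | \<nu> \<lessdot> \<rho>. num_lvt k \<nu>) = Stirling (k + 1) (?n + 1) * num_syt \<rho>" if \<rho>: "\<mu> \<lessdot> \<rho>" for \<rho>
  proof -
    have "(\<Sum>\<nu> | \<nu> \<lessdot> \<rho>. num_lvt k \<nu>) = (\<Sum>\<nu> | \<nu> \<lessdot> \<rho>. Stirling (k + 1) (?n + 1) * num_syt \<nu>)"
      using covered_by_sum_list[OF \<rho>]
      by (intro sum.cong refl) (simp add: Suc.IH covered_by_partition covered_by_sum_list)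
    moreover have "\<rho> \<noteq> []" using \<rho> not_covered_by_Nil by auto
    ultimately show ?thesis
      using num_syt_branching[OF covered_by_partition(2)[OF \<rho>]]
      by (simp add: sum_distrib_left)
  qed
  then have "(\<Sum>\<rho> | \<mu> \<lessdot> \<rho>. \<Sum>\<nu> | \<nu> \<lessdot> \<rho>. num_lvt k \<nu>) =
      Stirling (k + 1) (?n + 1) * (\<Sum>\<rho> | \<mu> \<lessdot> \<rho>. num_syt \<rho>)"
    by (simp add: sum_distrib_left)
  with stay show ?case
    using Suc.prems by (simp add: num_lvt_Suc sum_num_syt_upper_covers algebra_simps)
qed

lemma total_num_lvt_eq:
  "total_num_lvt k = (\<Sum>j=0..k. Stirling (k + 1) (j + 1) * (\<Sum>\<mu>\<in>partitions_of j. num_syt \<mu>))"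
proof -
  let ?P = "{\<mu>. integer_partition \<mu> \<and> sum_list \<mu> \<le> k}"
  \<comment> \<open>larger shapes have no tableaux, as \<open>S(k + 1, j + 1) = 0\<close> for \<open>j > k\<close>\<close>
  have "total_num_lvt k = (\<Sum>\<^sub>\<infinity>\<mu>\<in>?P. num_lvt k \<mu>)"
    unfolding total_num_lvt_def
    by (rule infsum_cong_neutral) (auto simp: num_lvt_eq)
  also have "\<dots> = (\<Sum>\<mu>\<in>?P. num_lvt k \<mu>)"
    by (rule infsum_finite) (rule finite_partitions_le)
  also have "\<dots> = (\<Sum>j=0..k. \<Sum>\<mu> | \<mu> \<in> ?P \<and> sum_list \<mu> = j. num_lvt k \<mu>)"
    by (rule sum.group[symmetric]) (auto simp: finite_partitions_le)
  also have "\<dots> = (\<Sum>j=0..k. Stirling (k + 1) (j + 1) * (\<Sum>\<mu>\<in>partitions_of j. num_syt \<mu>))"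
    unfolding sum_distrib_left
    by (intro sum.cong) (auto simp: partitions_of_def num_lvt_eq)
  finally show ?thesis .
qed

section \<open>Tableaux and involutions\<close>

text \<open>
  The telephone numbers, the common solution of the recurrences for tableaux and involutions.
\<close>

fun telephone :: "nat \<Rightarrow> nat" where
  "telephone 0 = 1"
| "telephone (Suc 0) = 1"
| "telephone (Suc (Suc n)) = telephone (Suc n) + Suc n * telephone n"

lemma sum_covers_swap:
  "(\<Sum>\<rho>\<in>partitions_of (Suc n). \<Sum>\<mu> | \<mu> \<lessdot> \<rho>. g \<rho> \<mu>) = (\<Sum>\<mu>\<in>partitions_of n. \<Sum>\<rho> | \<mu> \<lessdot> \<rho>. (g \<rho> \<mu> :: nat))"
proof -
  have "(SIGMA \<rho>:partitions_of (Suc n). {\<mu>. \<mu> \<lessdot> \<rho>}) =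
      prod.swap ` (SIGMA \<mu>:partitions_of n. {\<rho>. \<mu> \<lessdot> \<rho>})"
    by (force simp: partitions_of_def covered_by_partition dest: covered_by_sum_list)
  then show ?thesis
    by (simp add: sum.Sigma finite_partitions_of finite_upper_covers finite_lower_covers sum.reindex case_prod_unfold)
qed

text \<open>
  Counting cover relations between two levels from below, each \<open>\<mu>\<close> has one upper cover more than it
  has lower covers; the extra one gives the first summand.
\<close>

lemma sum_num_syt_Suc:
  "(\<Sum>\<rho>\<in>partitions_of (Suc n). num_syt \<rho>) =
     (\<Sum>\<mu>\<in>partitions_of n. num_syt \<mu>) + (\<Sum>\<mu>\<in>partitions_of n. \<Sum>\<kappa> | \<kappa> \<lessdot> \<mu>. num_syt \<mu>)"
proof -
  have "(\<Sum>\<rho>\<in>partitions_of (Suc n). num_syt \<rho>) = (\<Sum>\<rho>\<in>partitions_of (Suc n). \<Sum>\<mu> | \<mu> \<lessdot> \<rho>. num_syt \<mu>)"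
    by (intro sum.cong refl num_syt_branching) (auto simp: partitions_of_def)
  also have "\<dots> = (\<Sum>\<mu>\<in>partitions_of n. \<Sum>\<rho> | \<mu> \<lessdot> \<rho>. num_syt \<mu>)"
    by (rule sum_covers_swap)
  also have "\<dots> = (\<Sum>\<mu>\<in>partitions_of n. num_syt \<mu> + (\<Sum>\<kappa> | \<kappa> \<lessdot> \<mu>. num_syt \<mu>))"
    by (intro sum.cong refl) (simp add: card_upper_covers_eq_Suc_lower partitions_of_def)
  finally show ?thesis by (simp add: sum.distrib)
qed

lemma sum_num_syt_eq_telephone: "(\<Sum>\<mu>\<in>partitions_of n. num_syt \<mu>) = telephone n"
proof (induction n rule: telephone.induct)
  case 1
  show ?case by (simp add: partitions_of_0 num_syt_Nil)
next
  case 2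
  show ?case using sum_num_syt_Suc[of 0]
    by (simp add: partitions_of_0 num_syt_Nil not_covered_by_Nil)
next
  case (3 n)
  have "(\<Sum>\<mu>\<in>partitions_of (Suc n). \<Sum>\<kappa> | \<kappa> \<lessdot> \<mu>. num_syt \<mu>) =
      (\<Sum>\<kappa>\<in>partitions_of n. Suc n * num_syt \<kappa>)"
    unfolding sum_covers_swap
    by (intro sum.cong refl) (auto simp: sum_num_syt_upper_covers partitions_of_def)
  also have "\<dots> = Suc n * telephone n"
    unfolding 3(2)[symmetric] by (rule sum_distrib_left[symmetric])
  finally show ?case
    using 3(1) sum_num_syt_Suc[of "Suc n"] by simp
qed

text \<open>
  The recurrence removes arbitrary points, so involutions are counted on arbitrary finite sets; this
  avoids relabelling the remaining points to an initial segment.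
\<close>

definition involutions_on :: "'a set \<Rightarrow> ('a \<Rightarrow> 'a) set" where
  "involutions_on A = {\<sigma>. \<sigma> permutes A \<and> \<sigma> \<circ> \<sigma> = id}"

lemma finite_involutions_on: "finite A \<Longrightarrow> finite (involutions_on A)"
  by (rule finite_subset[OF _ finite_permutations]) (auto simp: involutions_on_def)

lemma involutions_on_iff:
  "\<sigma> \<in> involutions_on A \<longleftrightarrow> (\<forall>x. \<sigma> (\<sigma> x) = x) \<and> (\<forall>x. x \<notin> A \<longrightarrow> \<sigma> x = x)"
  unfolding involutions_on_def permutes_def mem_Collect_eq fun_eq_iff comp_apply id_apply by metis

lemma involutions_on_fixing:
  assumes "a \<notin> A"
  shows "{\<sigma> \<in> involutions_on (insert a A). \<sigma> a = a} = involutions_on A"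
  using assms by (auto simp: involutions_on_iff)

lemma card_involutions_on_swapping:
  assumes "a \<notin> A" "b \<in> A"
  shows "card {\<sigma> \<in> involutions_on (insert a A). \<sigma> a = b} = card (involutions_on (A - {b}))"
    (is "card ?S = card ?T")
proof (rule bij_betw_same_card)
  have ab: "a \<noteq> b" using assms by auto
  have S: "\<sigma> x \<noteq> a" "\<sigma> x \<noteq> b" if "\<sigma> \<in> ?S" "x \<noteq> a" "x \<noteq> b" for \<sigma> x
    using that unfolding mem_Collect_eq involutions_on_iff by metis+
  have T: "\<tau> a = a" "\<tau> b = b" if "\<tau> \<in> ?T" for \<tau>
    using that assms by (auto simp: involutions_on_iff)
  have T': "\<tau> x \<noteq> a" "\<tau> x \<noteq> b" if "\<tau> \<in> ?T" "x \<noteq> a" "x \<noteq> b" for \<tau> x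
    using that T[OF that(1)] unfolding involutions_on_iff by metis+
  show "bij_betw (\<lambda>\<sigma>. \<sigma>(a := a, b := b)) ?S ?T"
  proof (rule bij_betw_byWitness[where f' = "\<lambda>\<tau>. \<tau>(a := b, b := a)"])
    show "\<forall>\<sigma>\<in>?S. (\<sigma>(a := a, b := b))(a := b, b := a) = \<sigma>"
      by (auto simp: involutions_on_iff fun_eq_iff)
    show "\<forall>\<tau>\<in>?T. (\<tau>(a := b, b := a))(a := a, b := b) = \<tau>"
      by (intro ballI ext) (simp add: T)
    show "(\<lambda>\<sigma>. \<sigma>(a := a, b := b)) ` ?S \<subseteq> ?T"
    proof (rule image_subsetI)
      fix \<sigma> assume \<sigma>: "\<sigma> \<in> ?S"
      then have "\<forall>x. \<sigma> (\<sigma> x) = x" "\<forall>x. x \<notin> insert a A \<longrightarrow> \<sigma> x = x"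
        by (simp_all add: involutions_on_iff)
      with S[OF \<sigma>] show "\<sigma>(a := a, b := b) \<in> ?T"
        unfolding involutions_on_iff by simp
    qed
    show "(\<lambda>\<tau>. \<tau>(a := b, b := a)) ` ?T \<subseteq> ?S"
    proof (rule image_subsetI)
      fix \<tau> assume \<tau>: "\<tau> \<in> ?T"
      then have "\<forall>x. \<tau> (\<tau> x) = x" "\<forall>x. x \<notin> A - {b} \<longrightarrow> \<tau> x = x"
        by (simp_all add: involutions_on_iff)
      with T'[OF \<tau>] ab assms show "\<tau>(a := b, b := a) \<in> ?S"
        unfolding mem_Collect_eq involutions_on_iff by auto
    qed
  qed
qed

lemma card_involutions_on: "finite A \<Longrightarrow> card (involutions_on A) = telephone (card A)"
proof (induction "card A" arbitrary: A rule: less_induct)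
  case less
  show ?case
  proof (cases "A = {}")
    case True
    have "involutions_on ({} :: 'a set) = {id}" by (auto simp: involutions_on_def)
    with True show ?thesis by simp
  next
    case False
    then obtain a B where A: "A = insert a B" "a \<notin> B" by (metis ex_in_conv mk_disjoint_insert)
    then have B: "finite B" using less.prems by simp
    have "\<sigma> a \<in> A" if "\<sigma> \<in> involutions_on A" for \<sigma>
      using that A(1) unfolding involutions_on_iff by (metis insertI1)
    then have "involutions_on A = (\<Union>b\<in>A. {\<sigma> \<in> involutions_on A. \<sigma> a = b})" by blast
    then have "card (involutions_on A) = card (\<Union>b\<in>A. {\<sigma> \<in> involutions_on A. \<sigma> a = b})" by simp
    also have "\<dots> = (\<Sum>b\<in>A. card {\<sigma> \<in> involutions_on A. \<sigma> a = b})"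
      using less.prems finite_involutions_on[OF less.prems] by (intro card_UN_disjoint) auto
    also have "\<dots> = card (involutions_on B) + (\<Sum>b\<in>B. card (involutions_on (B - {b})))"
      using A B by (simp add: involutions_on_fixing card_involutions_on_swapping)
    also have "\<dots> = telephone (card B) + card B * telephone (card B - 1)"
      using less.hyps A B by (simp add: card_gt_0_iff)
    also have "\<dots> = telephone (card A)"
      using A B by (cases "card B") auto
    finally show ?thesis .
  qed
qed

lemma num_involutions_eq_telephone: "num_involutions n = telephone n"
  using card_involutions_on[of "{1..n}"] by (simp add: num_involutions_def involutions_on_def)

theorem theorem21:
  fixes k :: nat
  shows "total_num_lvt k =
           (\<Sum>j=0..k. Stirling (k + 1) (j + 1) * (\<Sum>\<mu>\<in>partitions_of j. num_syt \<mu>)) \<and>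
         (\<Sum>j=0..k. Stirling (k + 1) (j + 1) * (\<Sum>\<mu>\<in>partitions_of j. num_syt \<mu>)) =
           (\<Sum>j=0..k. Stirling (k + 1) (j + 1) * num_involutions j)"
  by (simp add: total_num_lvt_eq sum_num_syt_eq_telephone num_involutions_eq_telephone del: Stirling.simps)

end
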